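(* Let $i\in\{1,\ldots,n\}$ be an agent with $\cos\theta_i<1$. Then the eigenvalues associated with agent $i$, i.e. all $\lambda\in\mathbb{C}$ satisfying the $i$-th block Gershgorin condition $$\left\Vert \left( m_i D(\theta_i)-\lambda I_2\right)^{-1}\right\Vert^{-1}\le \sum_{j\in\mathcal{N}_i}\Vert a_{ij}D(\theta_i)\Vert ,$$ lie within the circles (closed discs) of the complex plane with centers $(m_i\cos\theta_i,\ \pm m_i\sin\theta_i)$ and radius $m_i$; that is, $$(\mathrm{Re}\,\lambda-m_i\cos\theta_i)^2+(\mathrm{Im}\,\lambda+m_i\sin\theta_i)^2\le m_i^2 \quad\text{or}\quad (\mathrm{Re}\,\lambda-m_i\cos\theta_i)^2+(\mathrm{Im}\,\lambda-m_i\sin\theta_i)^2\le m_i^2 .$$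
   Context: Let $\mathcal{G}=(\mathcal{V},\mathcal{E})$ be a connected undirected graph without self-loops on $\mathcal{V}=\{1,\ldots,n\}$, with weights $a_{ij}=a_{ji}\in\{0,1\}$ ($a_{ij}=1$ iff $i$ and $j$ are neighbors, $a_{ii}=0$); $\mathcal{N}_i$ is the set of neighbors of $i$ and $m_i=|\mathcal{N}_i|=\sum_{j}a_{ij}$. Each agent $i$ has a misalignment angle $\theta_i\in\mathbb{R}$, and $D(\theta)=\begin{bmatrix}\cos\theta & -\sin\theta\\ \sin\theta & \cos\theta\end{bmatrix}$. The matrix under study is $\mathcal{L}^{out}\in\mathbb{R}^{2n\times 2n}$, whose $(i,i)$ block is $\sum_{j\in\mathcal{N}_i}a_{ij}D(\theta_i)=m_iD(\theta_i)$ and whose $(i,j)$ block, $j\ne i$, is $-a_{ij}D(\theta_i)$. The norm $\Vert\cdot\Vert$ is the spectral norm (largest singular value), and $\Vert M^{-1}\Vert^{-1}$ is read as $0$ when $M$ is singular. By the block Gershgorin theorem, every eigenvalue of $\mathcal{L}^{out}$ satisfies the $i$-th block Gershgorin condition displayed in the claim for at least one $i$; the eigenvalues "of agent $i$" (of the $i$-th row block) means the complex numbers $\lambda$ satisfying this condition for index $i$. *)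

theory Defs
  imports "HOL-Analysis.Analysis"
begin

definition neighbors :: "('n::finite \<Rightarrow> 'n \<Rightarrow> real) \<Rightarrow> 'n \<Rightarrow> 'n set" where
  "neighbors a i = {j. a i j = 1}"

definition nbr_count :: "('n::finite \<Rightarrow> 'n \<Rightarrow> real) \<Rightarrow> 'n \<Rightarrow> real" where
  "nbr_count a i = real (card (neighbors a i))"

definition graph_connected :: "('n::finite \<Rightarrow> 'n \<Rightarrow> real) \<Rightarrow> bool" where
  "graph_connected a \<longleftrightarrow> (\<forall>i j. (i, j) \<in> {(u, v). v \<in> neighbors a u}\<^sup>*)"

definition D :: "real \<Rightarrow> real^2^2" where
  "D \<phi> = vector [vector [cos \<phi>, - sin \<phi>], vector [sin \<phi>, cos \<phi>]]"

text \<open>The index \<open>(i, k)\<close> stands for coordinate \<open>k\<close> of agent \<open>i\<close>, so this is the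
  \<open>2n \<times> 2n\<close> matrix with \<open>n = CARD('n)\<close>.\<close>

definition Lout :: "('n::finite \<Rightarrow> 'n \<Rightarrow> real) \<Rightarrow> ('n \<Rightarrow> real) \<Rightarrow> real^('n \<times> 2)^('n \<times> 2)" where
  "Lout a \<theta> = (\<chi> p q.
     if fst p = fst q then (nbr_count a (fst p) *\<^sub>R D (\<theta> (fst p))) $ snd p $ snd q
     else (- (a (fst p) (fst q) *\<^sub>R D (\<theta> (fst p)))) $ snd p $ snd q)"

definition block :: "'a^('n \<times> 2)^('n \<times> 2) \<Rightarrow> 'n::finite \<Rightarrow> 'n \<Rightarrow> 'a^2^2" where
  "block L i j = (\<chi> k l. L $ (i, k) $ (j, l))"

definition conj_transpose :: "complex^'n^'m \<Rightarrow> complex^'m^'n" where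
  "conj_transpose A = (\<chi> i j. cnj (A $ j $ i))"

definition singular_values :: "complex^'n^'m \<Rightarrow> real set" where
  "singular_values A =
     {\<sigma>. 0 \<le> \<sigma> \<and> (\<exists>v. v \<noteq> 0 \<and> (conj_transpose A ** A) *v v = complex_of_real (\<sigma>\<^sup>2) *s v)}"

definition spectral_norm :: "complex^'n^'m \<Rightarrow> real" where
  "spectral_norm A = Max (singular_values A)"

text \<open>\<open>\<parallel>M\<^sup>-\<^sup>1\<parallel>\<^sup>-\<^sup>1\<close>, read as \<open>0\<close> for singular \<open>M\<close>; \<^const>\<open>matrix_inv\<close> is unspecified there.\<close>

definition inv_norm_inv :: "complex^'n^'n \<Rightarrow> real" where
  "inv_norm_inv M = (if invertible M then inverse (spectral_norm (matrix_inv M)) else 0)"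

text \<open>Real matrices enter the complex spectral conditions through their complexification,
  which has the same singular values.\<close>

abbreviation cmat :: "real^'n^'m \<Rightarrow> complex^'n^'m" where
  "cmat A \<equiv> map_matrix complex_of_real A"

definition block_gershgorin :: "real^('n \<times> 2)^('n \<times> 2) \<Rightarrow> 'n::finite \<Rightarrow> complex \<Rightarrow> bool" where
  "block_gershgorin L i z \<longleftrightarrow>
     inv_norm_inv (cmat (block L i i) - mat z) \<le> (\<Sum>j\<in>UNIV - {i}. spectral_norm (cmat (block L i j)))"

lemma spectral_norm_zero: "spectral_norm (0 :: complex^'n^'m) = 0"
proof -
  have "singular_values (0 :: complex^'n^'m) = {0}"
    unfolding singular_values_def
    by (auto simp: matrix_matrix_mult_def matrix_vector_mult_def vec_eq_iff conj_transpose_def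
             intro: exI [of _ "\<chi> i. 1"])
  then show ?thesis by (simp add: spectral_norm_def)
qed

lemma spectral_norm_minus: "spectral_norm (- A) = spectral_norm A"
proof -
  have "conj_transpose (- A) ** (- A) = conj_transpose A ** A"
    by (simp add: matrix_matrix_mult_def vec_eq_iff conj_transpose_def)
  then show ?thesis by (simp add: spectral_norm_def singular_values_def)
qed

text \<open>For \<^const>\<open>Lout\<close> the block Gershgorin condition of agent \<open>i\<close> takes the explicit form used
  in the main statement.\<close>

lemma block_gershgorin_Lout:
  fixes a :: "'n::finite \<Rightarrow> 'n \<Rightarrow> real"
  assumes "\<And>i j. a i j \<in> {0, 1}" and "\<And>i. a i i = 0"
  shows "block_gershgorin (Lout a \<theta>) i z \<longleftrightarrow>
    inv_norm_inv (cmat (nbr_count a i *\<^sub>R D (\<theta> i)) - mat z)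
      \<le> (\<Sum>j\<in>neighbors a i. spectral_norm (cmat (a i j *\<^sub>R D (\<theta> i))))"
proof -
  have diag: "block (Lout a \<theta>) i i = nbr_count a i *\<^sub>R D (\<theta> i)"
    by (simp add: block_def Lout_def vec_eq_iff)
  have off: "cmat (block (Lout a \<theta>) i j) = - cmat (a i j *\<^sub>R D (\<theta> i))" if "j \<noteq> i" for j
    using that by (simp add: block_def Lout_def vec_eq_iff map_matrix_def)
  have "(\<Sum>j\<in>UNIV - {i}. spectral_norm (cmat (block (Lout a \<theta>) i j)))
      = (\<Sum>j\<in>UNIV - {i}. spectral_norm (cmat (a i j *\<^sub>R D (\<theta> i))))"
    by (rule sum.cong) (simp_all add: off spectral_norm_minus)
  also have "\<dots> = (\<Sum>j\<in>neighbors a i. spectral_norm (cmat (a i j *\<^sub>R D (\<theta> i))))"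
  proof (rule sum.mono_neutral_right)
    show "neighbors a i \<subseteq> UNIV - {i}"
      using assms(2) by (auto simp: neighbors_def)
    have cmat0: "cmat (0 :: real^2^2) = 0"
      by (simp add: vec_eq_iff map_matrix_def)
    show "\<forall>j\<in>UNIV - {i} - neighbors a i. spectral_norm (cmat (a i j *\<^sub>R D (\<theta> i))) = 0"
    proof
      fix j assume "j \<in> UNIV - {i} - neighbors a i"
      then have "a i j = 0" using assms(1)[of i j] by (auto simp: neighbors_def)
      then show "spectral_norm (cmat (a i j *\<^sub>R D (\<theta> i))) = 0"
        by (simp only: scaleR_zero_left cmat0 spectral_norm_zero)
    qed
  qed simp
  finally show ?thesis by (simp only: block_gershgorin_def diag)
qed

end

theory Submission
  imports Defs
begin

text \<open>With \<open>J\<close> the rotation by a right angle, both \<open>D(\<theta>)\<close> and \<open>m D(\<theta>) - z I\<close> have the shape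
  \<open>p I + s J\<close>. Such matrices are normal, closed under products and adjoints, and diagonal in the
  basis \<open>(1, -\<i>)\<close>, \<open>(1, \<i>)\<close>, where they act as \<open>p + \<i> s\<close> and \<open>p - \<i> s\<close>. Hence their singular
  values are the moduli of these two numbers (\<open>singular_values_rot_scale\<close>).

  For \<open>D(\<theta>)\<close> both moduli are \<open>1\<close>, so every neighbour contributes \<open>1\<close> to the right-hand side of
  the Gershgorin condition, which becomes \<open>m\<close>. For \<open>M = m D(\<theta>) - z I\<close> the left-hand side
  is the smaller of the moduli of \<open>(m cos \<theta> - z) \<plusminus> \<i> m sin \<theta>\<close> (\<open>inv_norm_inv_rot_scale\<close>), that
  is, the distance from \<open>z\<close> to the nearer of the two eigenvalues \<open>m (cos \<theta> \<plusminus> \<i> sin \<theta>)\<close>. The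
  condition therefore says that \<open>z\<close> lies in one of the two discs.\<close>

text \<open>The matrix \<open>p I + s J\<close>. For complex \<open>p\<close> and \<open>s\<close> it is no longer a rotation followed by a
  scaling, but it keeps the algebra of one.\<close>

definition rot_scale :: "complex \<Rightarrow> complex \<Rightarrow> complex^2^2" where
  "rot_scale p s = vector [vector [p, - s], vector [s, p]]"

lemma rot_scale_mult:
  "rot_scale p s ** rot_scale q t = rot_scale (p * q - s * t) (p * t + s * q)"
  by (simp add: rot_scale_def vec_eq_iff forall_2 matrix_matrix_mult_def sum_2 algebra_simps)

lemma conj_transpose_rot_scale:
  "conj_transpose (rot_scale p s) = rot_scale (cnj p) (- cnj s)"
  by (simp add: rot_scale_def vec_eq_iff forall_2 conj_transpose_def)

lemma rot_scale_one: "rot_scale 1 0 = mat 1"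
  by (simp add: rot_scale_def vec_eq_iff forall_2 mat_def)

lemma cmat_D: "cmat (D \<phi>) = rot_scale (complex_of_real (cos \<phi>)) (complex_of_real (sin \<phi>))"
  by (simp add: D_def rot_scale_def vec_eq_iff forall_2 map_matrix_def)

lemma cmat_scaled_D_minus_mat:
  "cmat (m *\<^sub>R D \<phi>) - mat z
     = rot_scale (complex_of_real (m * cos \<phi>) - z) (complex_of_real (m * sin \<phi>))"
  by (simp add: D_def rot_scale_def vec_eq_iff forall_2 map_matrix_def mat_def)

text \<open>The coordinates \<open>v\<^sub>1 + \<i> v\<^sub>2\<close> and \<open>v\<^sub>1 - \<i> v\<^sub>2\<close> diagonalise the matrix; a nonzero vector has a
  nonzero coordinate, and the corresponding eigenvalue must then be \<open>l\<close>.\<close>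

lemma rot_scale_eigenvalue_iff:
  "(\<exists>v. v \<noteq> 0 \<and> rot_scale x y *v v = l *s v) \<longleftrightarrow> l = x + \<i> * y \<or> l = x - \<i> * y"
proof
  assume "\<exists>v. v \<noteq> 0 \<and> rot_scale x y *v v = l *s v"
  then obtain v where v: "v \<noteq> 0" and eig: "rot_scale x y *v v = l *s v" by blast
  have row1: "x * v$1 - y * v$2 = l * v$1" and row2: "y * v$1 + x * v$2 = l * v$2"
    using eig by (simp_all add: rot_scale_def vec_eq_iff forall_2 matrix_vector_mult_def sum_2)
  have "(x + \<i> * y - l) * (v$1 + \<i> * v$2)
      = (x * v$1 - y * v$2 - l * v$1) + \<i> * (y * v$1 + x * v$2 - l * v$2)"
    by (simp add: algebra_simps)
  then have plus: "(x + \<i> * y - l) * (v$1 + \<i> * v$2) = 0"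
    using row1 row2 by simp
  have "(x - \<i> * y - l) * (v$1 - \<i> * v$2)
      = (x * v$1 - y * v$2 - l * v$1) - \<i> * (y * v$1 + x * v$2 - l * v$2)"
    by (simp add: algebra_simps)
  then have minus: "(x - \<i> * y - l) * (v$1 - \<i> * v$2) = 0"
    using row1 row2 by simp
  have "v$1 + \<i> * v$2 \<noteq> 0 \<or> v$1 - \<i> * v$2 \<noteq> 0"
  proof (rule ccontr)
    assume "\<not> ?thesis"
    then have sum0: "v$1 + \<i> * v$2 = 0" and diff0: "v$1 - \<i> * v$2 = 0" by blast+
    have "v$1 = 0" using arg_cong2 [OF sum0 diff0, of "(+)"] by simp
    moreover have "v$2 = 0" using arg_cong2 [OF sum0 diff0, of "(-)"] by simp
    ultimately have "v = 0" by (simp add: vec_eq_iff forall_2)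
    with v show False ..
  qed
  with plus minus show "l = x + \<i> * y \<or> l = x - \<i> * y" by auto
next
  assume "l = x + \<i> * y \<or> l = x - \<i> * y"
  then show "\<exists>v. v \<noteq> 0 \<and> rot_scale x y *v v = l *s v"
  proof
    assume l: "l = x + \<i> * y"
    have "rot_scale x y *v vector [1, - \<i>] = l *s vector [1, - \<i>]"
      unfolding l
      by (simp add: rot_scale_def vec_eq_iff forall_2 matrix_vector_mult_def sum_2 algebra_simps)
    moreover have "(vector [1, - \<i>] :: complex^2) \<noteq> 0"
      by (simp add: vec_eq_iff forall_2)
    ultimately show ?thesis by blast
  next
    assume l: "l = x - \<i> * y"
    have "rot_scale x y *v vector [1, \<i>] = l *s vector [1, \<i>]"
      unfolding l
      by (simp add: rot_scale_def vec_eq_iff forall_2 matrix_vector_mult_def sum_2 algebra_simps)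
    moreover have "(vector [1, \<i>] :: complex^2) \<noteq> 0"
      by (simp add: vec_eq_iff forall_2)
    ultimately show ?thesis by blast
  qed
qed

lemma complex_of_real_power2_eq_norm_iff:
  assumes "0 \<le> \<sigma>"
  shows "complex_of_real (\<sigma>\<^sup>2) = w * cnj w \<longleftrightarrow> \<sigma> = cmod w"
proof -
  have "complex_of_real (\<sigma>\<^sup>2) = w * cnj w \<longleftrightarrow> \<sigma>\<^sup>2 = (cmod w)\<^sup>2"
    by (simp only: complex_norm_square [symmetric] of_real_eq_iff)
  also have "\<dots> \<longleftrightarrow> \<sigma> = cmod w"
    using assms by simp
  finally show ?thesis .
qed

text \<open>The Gram matrix again has the form \<open>x I + y J\<close>, and its eigenvalues \<open>x \<plusminus> \<i> y\<close> factor as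
  \<open>\<bar>p \<plusminus> \<i> s\<bar>\<^sup>2\<close>.\<close>

lemma singular_values_rot_scale:
  "singular_values (rot_scale p s) = {cmod (p + \<i> * s), cmod (p - \<i> * s)}"
proof -
  define x where "x = cnj p * p + cnj s * s"
  define y where "y = cnj p * s - cnj s * p"
  have gram: "conj_transpose (rot_scale p s) ** rot_scale p s = rot_scale x y"
    by (simp add: conj_transpose_rot_scale rot_scale_mult x_def y_def)
  have plus: "x + \<i> * y = (p + \<i> * s) * cnj (p + \<i> * s)"
    and minus: "x - \<i> * y = (p - \<i> * s) * cnj (p - \<i> * s)"
    by (simp_all add: x_def y_def algebra_simps)
  have "\<sigma> \<in> singular_values (rot_scale p s) \<longleftrightarrow> \<sigma> \<in> {cmod (p + \<i> * s), cmod (p - \<i> * s)}" for \<sigma>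
  proof -
    have "\<sigma> \<in> singular_values (rot_scale p s) \<longleftrightarrow>
        0 \<le> \<sigma> \<and> (complex_of_real (\<sigma>\<^sup>2) = x + \<i> * y \<or> complex_of_real (\<sigma>\<^sup>2) = x - \<i> * y)"
      unfolding singular_values_def gram rot_scale_eigenvalue_iff by blast
    also have "\<dots> \<longleftrightarrow> 0 \<le> \<sigma> \<and> (\<sigma> = cmod (p + \<i> * s) \<or> \<sigma> = cmod (p - \<i> * s))"
      unfolding plus minus using complex_of_real_power2_eq_norm_iff by blast
    also have "\<dots> \<longleftrightarrow> \<sigma> \<in> {cmod (p + \<i> * s), cmod (p - \<i> * s)}"
      by auto
    finally show ?thesis .
  qed
  then show ?thesis by blast
qed

lemma spectral_norm_rot_scale:
  "spectral_norm (rot_scale p s) = max (cmod (p + \<i> * s)) (cmod (p - \<i> * s))"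
  by (simp add: spectral_norm_def singular_values_rot_scale)

lemma spectral_norm_D: "spectral_norm (cmat (D \<phi>)) = 1"
proof -
  have "cmod (complex_of_real (cos \<phi>) + \<i> * complex_of_real (sin \<phi>)) = 1"
    and "cmod (complex_of_real (cos \<phi>) - \<i> * complex_of_real (sin \<phi>)) = 1"
    by (simp_all add: cmod_def)
  then show ?thesis by (simp add: cmat_D spectral_norm_rot_scale)
qed

lemma matrix_inv_unique:
  fixes A :: "'a::semiring_1^'n^'m"
  assumes right: "A ** B = mat 1" and left: "B ** A = mat 1"
  shows "matrix_inv A = B"
proof -
  have inv: "A ** matrix_inv A = mat 1 \<and> matrix_inv A ** A = mat 1"
    unfolding matrix_inv_def by (rule someI [of _ B]) (simp add: right left)
  have "matrix_inv A = (B ** A) ** matrix_inv A"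
    by (simp add: left)
  also have "\<dots> = B"
    using inv by (simp add: matrix_mul_assoc [symmetric])
  finally show ?thesis .
qed

text \<open>With \<open>d = (p + \<i> s) (p - \<i> s)\<close>, the inverse is \<open>(p I - s J) / d\<close>. Its eigenvalues are the
  reciprocals of \<open>p \<plusminus> \<i> s\<close>, so the largest modulus of the inverse is the reciprocal of the
  smallest modulus. If \<open>d = 0\<close>, one of the moduli is \<open>0\<close>, in accordance with the convention for
  singular matrices.\<close>

lemma inv_norm_inv_rot_scale:
  "inv_norm_inv (rot_scale p s) = min (cmod (p + \<i> * s)) (cmod (p - \<i> * s))"
proof -
  define d where "d = p * p + s * s"
  have d_factor: "d = (p + \<i> * s) * (p - \<i> * s)"
    by (simp add: d_def algebra_simps)
  show ?thesis
  proof (cases "d = 0")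
    case True
    have "det (rot_scale p s) = 0"
      using True by (simp add: det_2 rot_scale_def d_def)
    then have "inv_norm_inv (rot_scale p s) = 0"
      by (simp add: inv_norm_inv_def invertible_det_nz)
    moreover have "min (cmod (p + \<i> * s)) (cmod (p - \<i> * s)) = 0"
      using True by (auto simp: d_factor min_def)
    ultimately show ?thesis by simp
  next
    case False
    define B where "B = rot_scale (p / d) (- s / d)"
    have "(p * p + s * s) / d = 1"
      using False by (simp add: d_def)
    then have unit: "p * p / d + s * s / d = 1"
      by (simp add: add_divide_distrib)
    have right: "rot_scale p s ** B = mat 1" and left: "B ** rot_scale p s = mat 1"
      using unit by (simp_all add: B_def rot_scale_mult rot_scale_one [symmetric])
    then have inv: "invertible (rot_scale p s)" "matrix_inv (rot_scale p s) = B"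
      by (auto simp: invertible_def intro: matrix_inv_unique)
    have ne: "p + \<i> * s \<noteq> 0" "p - \<i> * s \<noteq> 0"
      using False by (auto simp: d_factor)
    have "p / d + \<i> * (- s / d) = (p - \<i> * s) / d"
      by (simp add: diff_divide_distrib)
    also have "\<dots> = inverse (p + \<i> * s)"
      unfolding d_factor using ne by (simp only: inverse_eq_divide) simp
    finally have plus: "p / d + \<i> * (- s / d) = inverse (p + \<i> * s)" .
    have "p / d - \<i> * (- s / d) = (p + \<i> * s) / d"
      by (simp add: add_divide_distrib)
    also have "\<dots> = inverse (p - \<i> * s)"
      unfolding d_factor using ne by (simp only: inverse_eq_divide) simp
    finally have minus: "p / d - \<i> * (- s / d) = inverse (p - \<i> * s)" .
    have "spectral_norm B
        = max (inverse (cmod (p + \<i> * s))) (inverse (cmod (p - \<i> * s)))"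
      by (simp only: B_def spectral_norm_rot_scale plus minus norm_inverse)
    then have "inv_norm_inv (rot_scale p s)
        = inverse (max (inverse (cmod (p + \<i> * s))) (inverse (cmod (p - \<i> * s))))"
      using inv by (simp add: inv_norm_inv_def)
    also have "\<dots> = min (cmod (p + \<i> * s)) (cmod (p - \<i> * s))"
      using ne by (auto simp: max_def min_def)
    finally show ?thesis .
  qed
qed

theorem theorem2:
  fixes a :: "'n::finite \<Rightarrow> 'n \<Rightarrow> real" and \<theta> :: "'n \<Rightarrow> real" and i :: 'n
  assumes weights: "\<And>j k. a j k \<in> {0, 1}"
    and symmetric: "\<And>j k. a j k = a k j"
    and no_loops: "\<And>j. a j j = 0"
    and connected: "graph_connected a"
    and misaligned: "cos (\<theta> i) < 1"
  shows "\<forall>z::complex.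
    inv_norm_inv (cmat (nbr_count a i *\<^sub>R D (\<theta> i)) - mat z)
      \<le> (\<Sum>j\<in>neighbors a i. spectral_norm (cmat (a i j *\<^sub>R D (\<theta> i)))) \<longrightarrow>
    (Re z - nbr_count a i * cos (\<theta> i))\<^sup>2 + (Im z + nbr_count a i * sin (\<theta> i))\<^sup>2 \<le> (nbr_count a i)\<^sup>2 \<or>
    (Re z - nbr_count a i * cos (\<theta> i))\<^sup>2 + (Im z - nbr_count a i * sin (\<theta> i))\<^sup>2 \<le> (nbr_count a i)\<^sup>2"
proof (intro allI impI)
  fix z :: complex
  define m where "m = nbr_count a i"
  define c where "c = m * cos (\<theta> i)"
  define s where "s = m * sin (\<theta> i)"
  define p where "p = complex_of_real c - z"
  assume cond: "inv_norm_inv (cmat (nbr_count a i *\<^sub>R D (\<theta> i)) - mat z)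
      \<le> (\<Sum>j\<in>neighbors a i. spectral_norm (cmat (a i j *\<^sub>R D (\<theta> i))))"
  have "(\<Sum>j\<in>neighbors a i. spectral_norm (cmat (a i j *\<^sub>R D (\<theta> i))))
      = (\<Sum>j\<in>neighbors a i. 1)"
    by (rule sum.cong) (simp_all add: neighbors_def spectral_norm_D)
  also have "\<dots> = m"
    by (simp add: m_def nbr_count_def)
  finally have "min (cmod (p + \<i> * s)) (cmod (p - \<i> * s)) \<le> m"
    using cond
    by (simp only: cmat_scaled_D_minus_mat inv_norm_inv_rot_scale p_def c_def s_def m_def)
  then have "cmod (p - \<i> * s) \<le> m \<or> cmod (p + \<i> * s) \<le> m"
    by linarith
  then have "(cmod (p - \<i> * s))\<^sup>2 \<le> m\<^sup>2 \<or> (cmod (p + \<i> * s))\<^sup>2 \<le> m\<^sup>2"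
    by (meson norm_ge_zero power_mono)
  moreover have "(cmod (p - \<i> * s))\<^sup>2 = (Re z - c)\<^sup>2 + (Im z + s)\<^sup>2"
    and "(cmod (p + \<i> * s))\<^sup>2 = (Re z - c)\<^sup>2 + (Im z - s)\<^sup>2"
    unfolding p_def cmod_power2 by (simp_all add: power2_eq_square algebra_simps)
  ultimately show "(Re z - nbr_count a i * cos (\<theta> i))\<^sup>2 + (Im z + nbr_count a i * sin (\<theta> i))\<^sup>2
        \<le> (nbr_count a i)\<^sup>2 \<or>
      (Re z - nbr_count a i * cos (\<theta> i))\<^sup>2 + (Im z - nbr_count a i * sin (\<theta> i))\<^sup>2
        \<le> (nbr_count a i)\<^sup>2"
    by (simp only: c_def s_def m_def)
qed

end
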